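(* Let $G=(V,E)$ be a DAG and $M$ a cache size, and let $\psi$ be any $r^{(top)}$-visit of $G_R$. Then there exists at least one segment partition $\mathbf{i}=(i_1,\ldots,i_k)$ of $\psi$ such that $\mathcal{W}_{r^{(top)}}(\mathbf{i},\psi,M)+\mathcal{R}_{r^{(top)}}(\mathbf{i},\psi,M)\geq M\,(k(G,2M)-1)$; consequently $IO(G,M)\geq M\,(k(G,2M)-1)$.
   Context: DAG $G=(V,E)$: inputs $I$ have no predecessors, outputs $O$ no successors. The reverse DAG is $G_R=(V,E_R)$, $E_R=\{(u,v):(v,u)\in E\}$, with input set $I_R=O$. The topological rule on $G_R$ is $r^{(top)}(v)=\{\text{set of all predecessors of } v \text{ in } G_R\}$; an $r^{(top)}$-visit of $G_R$ is a topological ordering of $G_R$, and for a sequence $\psi$, $B_{r^{(top)}}(\psi)$ is the set of vertices not in $\psi$ that have at least one predecessor in $G_R$ and all of whose $G_R$-predecessors lie in $\psi$ (empty when $\psi$ is empty). A segment partition of a visit $\psi$ of $n=|V|$ vertices is $\mathbf{i}=(i_1,\ldots,i_k)$ with $1\le i_1<\cdots<i_k=n$, $i_0=0$; the $j$-th segment is $\psi(i_{j-1}..i_j]=(\psi[i_{j-1}+1],\ldots,\psi[i_j])$. Entering boundary $b^{(ent)}_{r}(\psi(i_{j-1}..i_j])=|(I_R\cup B_{r}(\psi[1..i_{j-1}]))\cap\psi(i_{j-1}..i_j]|$. $P$ is a post-dominator of $X$ in $G_R$ if every directed path of $G_R$ from $X$ to an output of $G_R$ meets $P$; $pd_{min}(X)$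 is its minimum size. $\mathcal{W}_r(\mathbf{i},\psi,M)=\sum_{j=1}^{k}\max\{0,b^{(ent)}_r(\psi(i_{j-1}..i_j])-M\}$, $\mathcal{R}_r(\mathbf{i},\psi,M)=\sum_{j=1}^{k}\max\{0,pd_{min}(\psi(i_{j-1}..i_j])-M\}$. A set $D$ is a dominator of $V'\subseteq V$ in $G$ if every directed path from an input of $G$ to a vertex of $V'$ meets $D$; the minimum set of $V'$ is the set of vertices of $V'$ with no successor in $V'$. An $S$-partition of $G$ is a sequence $(V_1,\ldots,V_m)$ of disjoint sets with union $V$ such that each $V_j$ has a dominator of size at most $S$, the minimum set of each $V_j$ has size at most $S$, and there is no edge of $G$ from a vertex of $V_j$ to a vertex of $\bigcup_{i<j}V_i$; $k(G,S)$ is the minimum number of sets in an $S$-partition of $G$. I/O model: cache of $M$ words, unbounded slow memory, one vertex value per word; a computation is a sequence of operations (evaluate $v\in V\setminus I$ into cache, requiring its $G$-predecessors in cache), reads (slow memory to cache) and writes (cache to slow memory), with at most $M$ values in cache at any time, recomputation allowed, inputs initially in slow memory only, outputs in slow memory at the end; $IO(G,M)$ is the minimum number of reads plus writes over all computations.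
   Formalization: The bound on IO(G,M) is proved for DAGs in which no vertex is both an input and an output; without this it fails (three isolated vertices, M=1: IO=0 but M(k(G,2M)-1)=1). The W+R bound is proved for every DAG. *)

theory Defs
  imports Main "HOL-Library.Extended_Nat"
begin

section \<open>DAGs\<close>

text \<open>
  A graph is given by its vertex set \<open>V\<close> and its edge relation \<open>E\<close>; the reverse of
  the graph \<open>(V, E)\<close> is \<open>(V, E\<inverse>)\<close>.
\<close>

definition dag :: "'v set \<Rightarrow> ('v \<times> 'v) set \<Rightarrow> bool" where
  "dag V E \<longleftrightarrow> finite V \<and> E \<subseteq> V \<times> V \<and> acyclic E"

definition inputs :: "'v set \<Rightarrow> ('v \<times> 'v) set \<Rightarrow> 'v set" where
  "inputs V E = {v \<in> V. \<forall>u. (u, v) \<notin> E}"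

definition outputs :: "'v set \<Rightarrow> ('v \<times> 'v) set \<Rightarrow> 'v set" where
  "outputs V E = {v \<in> V. \<forall>u. (v, u) \<notin> E}"

definition preds :: "('v \<times> 'v) set \<Rightarrow> 'v \<Rightarrow> 'v set" where
  "preds E v = {u. (u, v) \<in> E}"

text \<open>Directed paths as nonempty vertex lists; a single vertex is a path of length 0.\<close>

definition dpath :: "('v \<times> 'v) set \<Rightarrow> 'v list \<Rightarrow> bool" where
  "dpath E p \<longleftrightarrow> p \<noteq> [] \<and> successively (\<lambda>u v. (u, v) \<in> E) p"


section \<open>Visits under the topological rule\<close>

text \<open>
  In this section \<open>(V, E)\<close> is the graph being visited, so everything is to be
  instantiated with the reverse DAG.
\<close>

definition top_visit :: "'v set \<Rightarrow> ('v \<times> 'v) set \<Rightarrow> 'v list \<Rightarrow> bool" where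
  "top_visit V E \<psi> \<longleftrightarrow> distinct \<psi> \<and> set \<psi> = V \<and>
     (\<forall>i < length \<psi>. \<forall>j < length \<psi>. (\<psi> ! i, \<psi> ! j) \<in> E \<longrightarrow> i < j)"

definition top_boundary :: "'v set \<Rightarrow> ('v \<times> 'v) set \<Rightarrow> 'v list \<Rightarrow> 'v set" where
  "top_boundary V E \<psi> = {v \<in> V. v \<notin> set \<psi> \<and> preds E v \<noteq> {} \<and> preds E v \<subseteq> set \<psi>}"

text \<open>
  The list \<open>is\<close> holds \<open>i\<^sub>1, \<dots>, i\<^sub>k\<close>, so that \<open>(0 # is) ! j\<close> is \<open>i\<^sub>j\<close> for \<open>0 \<le> j \<le> k\<close>.
  The empty list is a segment partition exactly if \<open>n = 0\<close>.
\<close>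

definition segment_partition :: "nat \<Rightarrow> nat list \<Rightarrow> bool" where
  "segment_partition n is \<longleftrightarrow> sorted_wrt (<) (0 # is) \<and> last (0 # is) = n"

definition prefix_before :: "nat list \<Rightarrow> 'v list \<Rightarrow> nat \<Rightarrow> 'v list" where
  "prefix_before is \<psi> j = take ((0 # is) ! (j - 1)) \<psi>"

definition segment :: "nat list \<Rightarrow> 'v list \<Rightarrow> nat \<Rightarrow> 'v list" where
  "segment is \<psi> j = drop ((0 # is) ! (j - 1)) (take ((0 # is) ! j) \<psi>)"

definition b_ent :: "'v set \<Rightarrow> ('v \<times> 'v) set \<Rightarrow> nat list \<Rightarrow> 'v list \<Rightarrow> nat \<Rightarrow> nat" where
  "b_ent V E is \<psi> j =
     card ((inputs V E \<union> top_boundary V E (prefix_before is \<psi> j)) \<inter> set (segment is \<psi> j))"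

definition post_dominator :: "'v set \<Rightarrow> ('v \<times> 'v) set \<Rightarrow> 'v set \<Rightarrow> 'v set \<Rightarrow> bool" where
  "post_dominator V E P X \<longleftrightarrow> P \<subseteq> V \<and>
     (\<forall>p. dpath E p \<and> hd p \<in> X \<and> last p \<in> outputs V E \<longrightarrow> set p \<inter> P \<noteq> {})"

definition pd_min :: "'v set \<Rightarrow> ('v \<times> 'v) set \<Rightarrow> 'v set \<Rightarrow> nat" where
  "pd_min V E X = (LEAST m. \<exists>P. post_dominator V E P X \<and> card P = m)"

definition W_top :: "'v set \<Rightarrow> ('v \<times> 'v) set \<Rightarrow> nat list \<Rightarrow> 'v list \<Rightarrow> nat \<Rightarrow> int" where
  "W_top V E is \<psi> M = (\<Sum>j = 1..length is. max 0 (int (b_ent V E is \<psi> j) - int M))"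

definition R_top :: "'v set \<Rightarrow> ('v \<times> 'v) set \<Rightarrow> nat list \<Rightarrow> 'v list \<Rightarrow> nat \<Rightarrow> int" where
  "R_top V E is \<psi> M =
     (\<Sum>j = 1..length is. max 0 (int (pd_min V E (set (segment is \<psi> j))) - int M))"


section \<open>S-partitions\<close>

definition dominator :: "'v set \<Rightarrow> ('v \<times> 'v) set \<Rightarrow> 'v set \<Rightarrow> 'v set \<Rightarrow> bool" where
  "dominator V E D X \<longleftrightarrow> D \<subseteq> V \<and>
     (\<forall>p. dpath E p \<and> hd p \<in> inputs V E \<and> last p \<in> X \<longrightarrow> set p \<inter> D \<noteq> {})"

definition minimum_set :: "('v \<times> 'v) set \<Rightarrow> 'v set \<Rightarrow> 'v set" where
  "minimum_set E X = {v \<in> X. \<forall>w \<in> X. (v, w) \<notin> E}"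

definition S_partition :: "'v set \<Rightarrow> ('v \<times> 'v) set \<Rightarrow> nat \<Rightarrow> 'v set list \<Rightarrow> bool" where
  "S_partition V E S Vs \<longleftrightarrow>
     \<Union> (set Vs) = V \<and>
     (\<forall>j < length Vs. \<forall>i < j. Vs ! i \<inter> Vs ! j = {}) \<and>
     (\<forall>X \<in> set Vs. \<exists>D. dominator V E D X \<and> card D \<le> S) \<and>
     (\<forall>X \<in> set Vs. card (minimum_set E X) \<le> S) \<and>
     (\<forall>j < length Vs. \<forall>u \<in> Vs ! j. \<forall>v \<in> (\<Union>i<j. Vs ! i). (u, v) \<notin> E)"

text \<open>
  For \<open>S \<ge> 1\<close> an \<open>S\<close>-partition of a DAG always exists (singletons in topological order);
  for \<open>S = 0\<close> and \<open>V \<noteq> {}\<close> there is none and the value is unspecified.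
\<close>

definition k_part :: "'v set \<Rightarrow> ('v \<times> 'v) set \<Rightarrow> nat \<Rightarrow> nat" where
  "k_part V E S = (LEAST m. \<exists>Vs. S_partition V E S Vs \<and> length Vs = m)"


section \<open>The I/O model\<close>

text \<open>
  A state is a pair of the cache content and the slow memory content. Dropping a value
  from the cache is a separate step that costs nothing; in particular the result of an
  evaluation does not overwrite an operand, so operands and result are in cache together.
\<close>

datatype 'v action = Evaluate 'v | Read 'v | Write 'v | Discard 'v

inductive io_step ::
  "'v set \<Rightarrow> ('v \<times> 'v) set \<Rightarrow> nat \<Rightarrow> 'v set \<times> 'v set \<Rightarrow> 'v action \<Rightarrow> 'v set \<times> 'v set \<Rightarrow> bool"
  for V :: "'v set" and E :: "('v \<times> 'v) set" and M :: nat
where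
  evaluate: "v \<in> V - inputs V E \<Longrightarrow> preds E v \<subseteq> C \<Longrightarrow> card (insert v C) \<le> M \<Longrightarrow>
    io_step V E M (C, S) (Evaluate v) (insert v C, S)"
| read: "v \<in> S \<Longrightarrow> card (insert v C) \<le> M \<Longrightarrow>
    io_step V E M (C, S) (Read v) (insert v C, S)"
| "write": "v \<in> C \<Longrightarrow> io_step V E M (C, S) (Write v) (C, insert v S)"
| discard: "io_step V E M (C, S) (Discard v) (C - {v}, S)"

inductive io_run ::
  "'v set \<Rightarrow> ('v \<times> 'v) set \<Rightarrow> nat \<Rightarrow> 'v set \<times> 'v set \<Rightarrow> 'v action list \<Rightarrow> 'v set \<times> 'v set \<Rightarrow> bool"
  for V :: "'v set" and E :: "('v \<times> 'v) set" and M :: nat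
where
  Nil: "io_run V E M s [] s"
| Cons: "io_step V E M s a s' \<Longrightarrow> io_run V E M s' as s'' \<Longrightarrow> io_run V E M s (a # as) s''"

definition computation :: "'v set \<Rightarrow> ('v \<times> 'v) set \<Rightarrow> nat \<Rightarrow> 'v action list \<Rightarrow> bool" where
  "computation V E M as \<longleftrightarrow>
     (\<exists>C S. io_run V E M ({}, inputs V E) as (C, S) \<and> outputs V E \<subseteq> S)"

fun is_io :: "'v action \<Rightarrow> bool" where
  "is_io (Evaluate v) = False"
| "is_io (Read v) = True"
| "is_io (Write v) = True"
| "is_io (Discard v) = False"

definition io_cost :: "'v action list \<Rightarrow> nat" where
  "io_cost as = length (filter is_io as)"

text \<open>The value is \<open>\<infinity>\<close> if the cache is too small for any computation to exist.\<close>

definition IO :: "'v set \<Rightarrow> ('v \<times> 'v) set \<Rightarrow> nat \<Rightarrow> enat" where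
  "IO V E M = (INF as \<in> {as. computation V E M as}. enat (io_cost as))"

text \<open>
  A vertex that is both an input and an output starts in slow memory and needs no I/O, yet
  it counts in every \<open>S\<close>-partition: for three isolated vertices and \<open>M = 1\<close> we have
  \<open>IO = 0\<close> but \<open>M (k(G, 2M) - 1) = 1\<close>. Lower bounds on \<open>IO\<close> in terms of
  \<open>k_part\<close> therefore need the usual convention that DAGs have no isolated vertices.
\<close>

definition no_isolated :: "'v set \<Rightarrow> ('v \<times> 'v) set \<Rightarrow> bool" where
  "no_isolated V E \<longleftrightarrow> inputs V E \<inter> outputs V E = {}"

end

theory Submission
  imports Defs
begin

text \<open>
  A segment of a topological ordering of the reverse DAG has entering boundary equal to its minimum
  set and post-dominators equal to its dominators. Both minimal sizes grow by at most one
  when the segment is extended by a vertex, so the visit can be cut greedily into segments on which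
  the larger of the two is exactly \<open>2M\<close> (except for the last one); these segments, in reverse
  order, form a \<open>2M\<close>-partition.

  For the I/O bound, a computation is cut into phases of at most \<open>M\<close> I/O operations. With
  recomputation, the phase of a vertex has to be chosen carefully, from the outputs
  backwards: a vertex is charged to a step at which it enters the cache and after which it
  stays there until it is either written or needed by the first of the
  charged evaluations of its successors. Then a vertex in the minimum set of a phase is
  written in the phase or in cache at its end, and the vertices read in the phase or in cache at
  its beginning dominate the phase.
\<close>

section \<open>Partitions from monotone labellings\<close>

text \<open>The fibres of \<open>\<sigma>\<close>, listed by increasing label, form the partition:
  no edge decreases the label, hence none leads back to an earlier fibre. Empty fibres are
  admissible. It is applied to reversed segment indices and to phase numbers.\<close>

lemma k_part_le_labels:
  fixes \<sigma> :: "'v \<Rightarrow> nat"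
  assumes "\<And>v. v \<in> V \<Longrightarrow> \<sigma> v < h"
    and "\<And>u v. (u, v) \<in> E \<Longrightarrow> \<sigma> u \<le> \<sigma> v"
    and "\<And>i. i < h \<Longrightarrow> \<exists>D. dominator V E D {v \<in> V. \<sigma> v = i} \<and> card D \<le> S"
    and "\<And>i. i < h \<Longrightarrow> card (minimum_set E {v \<in> V. \<sigma> v = i}) \<le> S"
  shows "k_part V E S \<le> h"
proof -
  let ?Vs = "map (\<lambda>i. {v \<in> V. \<sigma> v = i}) [0..<h]"
  have "\<Union> (set ?Vs) = V" using assms(1) by auto
  moreover have "(u, v) \<notin> E"
    if "j < h" "u \<in> ?Vs ! j" "i < j" "v \<in> ?Vs ! i" for i j u v
    using that assms(2)[of u v] by auto
  ultimately have "S_partition V E S ?Vs"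
    unfolding S_partition_def using assms(3,4) by fastforce
  then show ?thesis
    unfolding k_part_def by (intro Least_le) (auto intro: exI[of _ ?Vs])
qed


section \<open>Segments of a visit\<close>

lemma dpath_converse: "dpath (E\<inverse>) p \<longleftrightarrow> dpath E (rev p)"
  by (simp add: dpath_def)

lemma outputs_converse: "outputs V (E\<inverse>) = inputs V E"
  by (auto simp: inputs_def outputs_def)

lemma post_dominator_converse: "post_dominator V (E\<inverse>) P X \<longleftrightarrow> dominator V E P X"
proof -
  have "(\<forall>p. dpath (E\<inverse>) p \<and> hd p \<in> X \<and> last p \<in> inputs V E \<longrightarrow> set p \<inter> P \<noteq> {}) \<longleftrightarrow>
        (\<forall>p. dpath E p \<and> hd p \<in> inputs V E \<and> last p \<in> X \<longrightarrow> set p \<inter> P \<noteq> {})"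
    (is "?L \<longleftrightarrow> ?R")
  proof
    assume L: ?L
    show ?R
    proof (intro allI impI)
      fix p assume "dpath E p \<and> hd p \<in> inputs V E \<and> last p \<in> X"
      then show "set p \<inter> P \<noteq> {}"
        using L[rule_format, of "rev p"] by (simp add: dpath_converse hd_rev last_rev)
    qed
  next
    assume R: ?R
    show ?L
    proof (intro allI impI)
      fix p assume "dpath (E\<inverse>) p \<and> hd p \<in> X \<and> last p \<in> inputs V E"
      then show "set p \<inter> P \<noteq> {}"
        using R[rule_format, of "rev p"] by (simp add: dpath_converse hd_rev last_rev)
    qed
  qed
  then show ?thesis
    by (simp add: post_dominator_def dominator_def outputs_converse)
qed

section \<open>Unit growth of the two minimal sizes\<close>

lemma pd_min_attained: "\<exists>P. post_dominator V E P X \<and> card P = pd_min V E X"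
proof -
  have "set p \<inter> V \<noteq> {}" if "dpath E p" "last p \<in> outputs V E" for p
    using that last_in_set[of p] unfolding dpath_def outputs_def by blast
  \<comment> \<open>\<open>V\<close> is a post-dominator of every set, so the \<open>LEAST\<close>
    in \<open>pd_min\<close> ranges over a nonempty set.\<close>
  then have "post_dominator V E V X"
    by (auto simp: post_dominator_def)
  then have "\<exists>m P. post_dominator V E P X \<and> card P = m" by blast
  then show ?thesis
    unfolding pd_min_def by (rule LeastI_ex)
qed

lemma pd_min_le: "post_dominator V E P X \<Longrightarrow> pd_min V E X \<le> card P"
  unfolding pd_min_def by (intro Least_le) blast

lemma pd_min_empty: "pd_min V E {} = 0"
  using pd_min_le[of V E "{}" "{}"] by (simp add: post_dominator_def)

text \<open>Adding \<open>x\<close> itself to an optimal post-dominator of \<open>X\<close> catches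
  the paths that start at \<open>x\<close>.\<close>

lemma pd_min_insert:
  assumes "x \<in> V" shows "pd_min V E (insert x X) \<le> Suc (pd_min V E X)"
proof -
  obtain P where P: "post_dominator V E P X" "card P = pd_min V E X"
    using pd_min_attained by blast
  have "set p \<inter> insert x P \<noteq> {}"
    if "dpath E p" "hd p \<in> insert x X" "last p \<in> outputs V E" for p
    using that P(1) hd_in_set[of p] by (auto simp: post_dominator_def dpath_def)
  then have "post_dominator V E (insert x P) (insert x X)"
    using P(1) assms by (auto simp: post_dominator_def)
  then have "pd_min V E (insert x X) \<le> card (insert x P)" by (rule pd_min_le)
  also have "\<dots> \<le> Suc (card P)"
    by (cases "finite P") (auto simp: card_insert_if)
  finally show ?thesis using P(2) by simp
qed

text \<open>A larger set leaves fewer of its old vertices without a successor inside, so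
  \<open>x\<close> is the only possible newcomer to the minimum set.\<close>

lemma card_minimum_set_insert:
  assumes "finite X"
  shows "card (minimum_set E (insert x X)) \<le> Suc (card (minimum_set E X))"
proof -
  have "minimum_set E (insert x X) \<subseteq> insert x (minimum_set E X)"
    by (auto simp: minimum_set_def)
  moreover have "finite (minimum_set E X)"
    using assms by (simp add: minimum_set_def)
  ultimately have "card (minimum_set E (insert x X)) \<le> card (insert x (minimum_set E X))"
    by (intro card_mono) auto
  also have "\<dots> \<le> Suc (card (minimum_set E X))"
    using \<open>finite (minimum_set E X)\<close> by (simp add: card_insert_if)
  finally show ?thesis .
qed

section \<open>Entering boundary of a segment\<close>

lemma drop_take_position:
  assumes "v \<in> set (drop a (take b xs))"
  obtains p where "p < length xs" "xs ! p = v" "p < b" "a \<le> p"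
proof -
  obtain i where "i < length (drop a (take b xs))" "drop a (take b xs) ! i = v"
    using assms by (auto simp: in_set_conv_nth)
  then show ?thesis by (intro that[of "a + i"]) (auto simp: drop_take)
qed

text \<open>Predecessors in the reverse graph are successors in \<open>E\<close>, and the visit
  places them before \<open>v\<close>. A vertex of the segment is thus without successors in the
  segment iff they all lie in the prefix; \<open>inputs\<close> covers the case of no successor,
  \<open>top_boundary\<close> the others.\<close>

lemma entering_boundary_eq_minimum_set:
  assumes E: "E \<subseteq> V \<times> V" and visit: "top_visit V (E\<inverse>) \<psi>"
  shows "(inputs V (E\<inverse>) \<union> top_boundary V (E\<inverse>) (take a \<psi>)) \<inter> set (drop a (take b \<psi>))
       = minimum_set E (set (drop a (take b \<psi>)))"
    (is "?B \<inter> ?X = _")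
proof (intro set_eqI iffI)
  have dist: "distinct \<psi>" and set: "set \<psi> = V" using visit by (auto simp: top_visit_def)
  have disj: "set (take a \<psi>) \<inter> ?X = {}"
    using dist set_take_disj_set_drop_if_distinct[of \<psi> a a]
    by (auto simp: drop_take dest: in_set_takeD)
  {
    fix v assume "v \<in> ?B \<inter> ?X"
    then show "v \<in> minimum_set E ?X"
      using disj by (auto simp: inputs_def top_boundary_def minimum_set_def preds_def)
  next
    fix v assume v: "v \<in> minimum_set E ?X"
    then have vX: "v \<in> ?X" by (simp add: minimum_set_def)
    then obtain p where p: "p < length \<psi>" "\<psi> ! p = v" "p < b"
      by (rule drop_take_position)
    have "w \<in> set (take a \<psi>)" if "(v, w) \<in> E" for w
    proof -
      from that E set obtain q where q: "q < length \<psi>" "\<psi> ! q = w"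
        by (metis in_set_conv_nth mem_Sigma_iff subsetD)
      then have "q < p" using visit that p by (auto simp: top_visit_def)
      have "q < a"
      proof (rule ccontr)
        assume "\<not> q < a"
        then have "w \<in> ?X"
          using q \<open>q < p\<close> p by (auto simp: in_set_conv_nth intro!: exI[of _ "q - a"])
        then show False using v that by (auto simp: minimum_set_def)
      qed
      then show ?thesis using q by (auto simp: in_set_conv_nth)
    qed
    then show "v \<in> ?B \<inter> ?X"
      using vX disj set p by (auto simp: inputs_def top_boundary_def preds_def)
  }
qed

text \<open>
  By the unit-increment hypothesis, \<open>f a\<close> either attains \<open>S\<close>, which gives the next cut, or stays
  below \<open>S\<close> up to \<open>n\<close>.
\<close>

lemma greedy_cuts:
  fixes f :: "nat \<Rightarrow> nat \<Rightarrow> nat"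
  assumes "a \<le> n" and "\<And>i. f i i < S"
    and "\<And>i j. i \<le> j \<Longrightarrow> j < n \<Longrightarrow> f i (Suc j) \<le> Suc (f i j)"
  shows "\<exists>is. sorted_wrt (<) (a # is) \<and> last (a # is) = n \<and>
           (\<forall>j < length is. f ((a # is) ! j) (is ! j) \<le> S) \<and>
           (\<forall>j. Suc j < length is \<longrightarrow> f ((a # is) ! j) (is ! j) = S)"
  using assms(1)
proof (induction "n - a" arbitrary: a rule: less_induct)
  case less
  consider "a = n" | b where "a < b" "b \<le> n" "f a b = S"
    | "a < n" "\<And>b. a < b \<Longrightarrow> b \<le> n \<Longrightarrow> f a b \<noteq> S"
    using less.prems by fastforce
  then show ?case
  proof cases
    case 1
    then show ?thesis by (intro exI[of _ "[]"]) simp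
  next
    case 2
    with less.hyps[of b] obtain js where js: "sorted_wrt (<) (b # js)" "last (b # js) = n"
      "\<forall>j < length js. f ((b # js) ! j) (js ! j) \<le> S"
      "\<forall>j. Suc j < length js \<longrightarrow> f ((b # js) ! j) (js ! j) = S"
      by (metis diff_less_mono2 less_le_trans)
    show ?thesis
    proof (intro exI[of _ "b # js"] conjI allI impI)
      show "f ((a # b # js) ! j) ((b # js) ! j) \<le> S" if "j < length (b # js)" for j
        using that js(3) 2 by (cases j) auto
      show "f ((a # b # js) ! j) ((b # js) ! j) = S" if "Suc j < length (b # js)" for j
        using that js(4) 2 by (cases j) auto
    qed (use js(1,2) 2 in auto)
  next
    case 3
    have "f a b < S" if "a \<le> b" "b \<le> n" for b
      using that
    proof (induction rule: dec_induct)
      case base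
      then show ?case using assms(2) by simp
    next
      case (step m)
      then show ?case using assms(3)[of a m] 3(2)[of "Suc m"] by fastforce
    qed
    then have "f a n < S" using 3 by simp
    then show ?thesis using 3 by (intro exI[of _ "[n]"]) auto
  qed
qed

section \<open>From segments to an S-partition\<close>

text \<open>Turns a position into the index of its segment. Labels count from 0 while segments count
  from 1, so label \<open>j\<close> belongs to segment \<open>Suc j\<close>.\<close>

lemma segment_label:
  fixes p :: nat
  assumes "sorted_wrt (<) (0 # is)" and "is \<noteq> []" and "p < last is"
  defines "l \<equiv> LEAST j. p < is ! j"
  shows "l < length is" and "j < length is \<Longrightarrow> l = j \<longleftrightarrow> (0 # is) ! j \<le> p \<and> p < is ! j"
proof -
  have ex: "p < is ! (length is - 1)"
    using assms(2,3) by (simp add: last_conv_nth)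
  then have "l \<le> length is - 1" unfolding l_def by (rule Least_le)
  then show ll: "l < length is" using assms(2) by (cases "is") auto
  have pl: "p < is ! l" unfolding l_def using ex by (rule LeastI)
  show "l = j \<longleftrightarrow> (0 # is) ! j \<le> p \<and> p < is ! j" if "j < length is"
  proof
    assume "l = j"
    then show "(0 # is) ! j \<le> p \<and> p < is ! j"
      using pl not_less_Least[of "j - 1" "\<lambda>j. p < is ! j"]
      by (cases j) (auto simp: l_def linorder_not_less)
  next
    assume j: "(0 # is) ! j \<le> p \<and> p < is ! j"
    then have "l \<le> j" unfolding l_def by (intro Least_le) simp
    moreover have "\<not> l < j"
    proof
      assume "l < j"
      then have "is ! l \<le> (0 # is) ! j"
        using assms(1) that sorted_wrt_nth_less[of "(<)" "is" l "j - 1"]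
        by (cases "l = j - 1"; cases j) auto
      then show False using pl j by simp
    qed
    ultimately show "l = j" by simp
  qed
qed

text \<open>Small entering boundaries are small minimum sets, and small post-dominators are small
  dominators, so the segments meet both size conditions of an S-partition.\<close>

lemma k_part_le_segments:
  assumes E: "E \<subseteq> V \<times> V" and visit: "top_visit V (E\<inverse>) \<psi>"
    and is_part: "segment_partition (length \<psi>) is"
    and b: "\<And>j. j < length is \<Longrightarrow> b_ent V (E\<inverse>) is \<psi> (Suc j) \<le> S"
    and pd: "\<And>j. j < length is \<Longrightarrow> pd_min V (E\<inverse>) (set (segment is \<psi> (Suc j))) \<le> S"
  shows "k_part V E S \<le> length is"
proof (cases "is = []")
  case True
  then have "V = {}" using is_part visit by (simp add: segment_partition_def top_visit_def)
  then have "S_partition V E S []" by (simp add: S_partition_def)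
  then have "k_part V E S \<le> 0" unfolding k_part_def by (intro Least_le) auto
  then show ?thesis by simp
next
  case False
  have dist: "distinct \<psi>" and set: "set \<psi> = V"
    and ord: "\<And>i j. i < length \<psi> \<Longrightarrow> j < length \<psi> \<Longrightarrow> (\<psi> ! j, \<psi> ! i) \<in> E \<Longrightarrow> i < j"
    using visit by (auto simp: top_visit_def)
  have sorted: "sorted_wrt (<) (0 # is)" and last: "last is = length \<psi>"
    using is_part False by (auto simp: segment_partition_def)
  have "\<exists>p. p < length \<psi> \<and> \<psi> ! p = v" if "v \<in> V" for v
    using that set by (metis in_set_conv_nth)
  then obtain pos where pos: "\<And>v. v \<in> V \<Longrightarrow> pos v < length \<psi> \<and> \<psi> ! pos v = v"
    by metis
  define lab where "lab v = (LEAST j. pos v < is ! j)" for v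
  have lab_less: "lab v < length is" if "v \<in> V" for v
    unfolding lab_def using segment_label(1)[OF sorted False] pos[OF that] last by simp
  have lab_iff: "lab v = j \<longleftrightarrow> (0 # is) ! j \<le> pos v \<and> pos v < is ! j"
    if "v \<in> V" "j < length is" for v j
    unfolding lab_def using segment_label(2)[OF sorted False _ that(2)] pos[OF that(1)] last by simp
  have lab_set: "{v \<in> V. lab v = j} = set (segment is \<psi> (Suc j))" if j: "j < length is" for j
  proof (intro set_eqI iffI)
    fix v assume "v \<in> {v \<in> V. lab v = j}"
    then show "v \<in> set (segment is \<psi> (Suc j))"
      using lab_iff[of v j] j pos[of v]
      by (auto simp: segment_def in_set_conv_nth intro!: exI[of _ "pos v - (0 # is) ! j"])
  next
    fix v assume "v \<in> set (segment is \<psi> (Suc j))"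
    then obtain q where q: "q < length \<psi>" "\<psi> ! q = v" "(0 # is) ! j \<le> q" "q < is ! j"
      using drop_take_position[of v "(0 # is) ! j" "is ! j" \<psi>] by (auto simp: segment_def)
    then have vV: "v \<in> V" using set by auto
    then have "pos v = q" using pos[OF vV] q dist nth_eq_iff_index_eq by blast
    then show "v \<in> {v \<in> V. lab v = j}" using q lab_iff[OF vV j] vV by simp
  qed
  define k where "k = length is"
  \<comment> \<open>An edge of \<open>E\<close> leads to a vertex visited earlier, so segment
    numbers must be reversed to grow along edges.\<close>
  define \<sigma> where "\<sigma> v = k - 1 - lab v" for v
  have \<sigma>_set: "{v \<in> V. \<sigma> v = i} = set (segment is \<psi> (Suc (k - 1 - i)))" if "i < k" for i
  proof -
    have "{v \<in> V. \<sigma> v = i} = {v \<in> V. lab v = k - 1 - i}"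
      using lab_less that by (fastforce simp: \<sigma>_def k_def)
    then show ?thesis using lab_set[of "k - 1 - i"] that by (simp add: k_def)
  qed
  have "k_part V E S \<le> k"
  proof (rule k_part_le_labels)
    show "\<sigma> v < k" if "v \<in> V" for v
      using False by (cases "is") (auto simp: \<sigma>_def k_def)
    show "\<sigma> u \<le> \<sigma> v" if "(u, v) \<in> E" for u v
    proof -
      have uv: "u \<in> V" "v \<in> V" using that E by auto
      then have "pos v < pos u" using ord[of "pos v" "pos u"] pos that by simp
      moreover have "pos u < is ! lab u" using lab_iff[OF uv(1) lab_less[OF uv(1)]] by simp
      ultimately have "lab v \<le> lab u" unfolding lab_def[of v] by (intro Least_le) simp
      then show ?thesis by (simp add: \<sigma>_def)
    qed
    fix i assume i: "i < k"
    then have j: "k - 1 - i < length is" by (simp add: k_def)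
    obtain P where "dominator V E P {v \<in> V. \<sigma> v = i}"
      "card P = pd_min V (E\<inverse>) (set (segment is \<psi> (Suc (k - 1 - i))))"
      using pd_min_attained[of V "E\<inverse>"] unfolding \<sigma>_set[OF i] post_dominator_converse by blast
    then show "\<exists>D. dominator V E D {v \<in> V. \<sigma> v = i} \<and> card D \<le> S"
      using pd[OF j] by auto
    show "card (minimum_set E {v \<in> V. \<sigma> v = i}) \<le> S"
      unfolding \<sigma>_set[OF i]
      using b[OF j] entering_boundary_eq_minimum_set[OF E visit]
      by (simp add: b_ent_def segment_def prefix_before_def)
  qed
  then show ?thesis by (simp add: k_def)
qed

lemma segment_partition_lower_bound:
  assumes "dag V E" and visit: "top_visit V (E\<inverse>) \<psi>"
  shows "\<exists>is. segment_partition (card V) is \<and>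
           int M * (int (k_part V E (2 * M)) - 1) \<le> W_top V (E\<inverse>) is \<psi> M + R_top V (E\<inverse>) is \<psi> M"
proof -
  have E: "E \<subseteq> V \<times> V" using assms(1) by (simp add: dag_def)
  have set: "set \<psi> = V" and n: "length \<psi> = card V"
    using visit distinct_card[of \<psi>] by (auto simp: top_visit_def)
  define X where "X i j = set (drop i (take j \<psi>))" for i j
  \<comment> \<open>The maximum grows by at most one per vertex, and once it equals
    \<open>2 * M\<close>, one of the two costs of the segment exceeds \<open>M\<close> by exactly
    \<open>M\<close>.\<close>
  define f where "f i j = max (card (minimum_set E (X i j))) (pd_min V (E\<inverse>) (X i j))" for i j
  have f_self: "f i i = 0" for i
    by (auto simp: f_def X_def minimum_set_def pd_min_empty)
  have f_Suc: "f i (Suc j) \<le> Suc (f i j)" if "i \<le> j" "j < card V" for i j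
  proof -
    have "X i (Suc j) = insert (\<psi> ! j) (X i j)" "\<psi> ! j \<in> V" "finite (X i j)"
      using that n set by (auto simp: X_def take_Suc_conv_app_nth)
    then show ?thesis
      using card_minimum_set_insert[of "X i j" E "\<psi> ! j"] pd_min_insert[of "\<psi> ! j" V "E\<inverse>" "X i j"]
      by (auto simp: f_def)
  qed
  \<comment> \<open>For \<open>M = 0\<close> the greedy hypothesis \<open>f i i < 2 * M\<close>
    fails, but the bound to be proved is then 0 and any segment partition serves.\<close>
  have "\<exists>is. sorted_wrt (<) (0 # is) \<and> last (0 # is) = card V \<and>
           (M > 0 \<longrightarrow> (\<forall>j < length is. f ((0 # is) ! j) (is ! j) \<le> 2 * M) \<and>
           (\<forall>j. Suc j < length is \<longrightarrow> f ((0 # is) ! j) (is ! j) = 2 * M))"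
  proof (cases "M = 0")
    case True
    then show ?thesis
      by (intro exI[of _ "if card V = 0 then [] else [card V]"]) simp
  next
    case False
    then show ?thesis
      using greedy_cuts[of 0 "card V" f "2 * M"] f_self f_Suc by simp
  qed
  then obtain "is" where "is": "sorted_wrt (<) (0 # is)" "last (0 # is) = card V"
    "M > 0 \<Longrightarrow> \<forall>j < length is. f ((0 # is) ! j) (is ! j) \<le> 2 * M"
    "M > 0 \<Longrightarrow> \<forall>j. Suc j < length is \<longrightarrow> f ((0 # is) ! j) (is ! j) = 2 * M"
    by blast
  have part: "segment_partition (length \<psi>) is" using "is"(1,2) n by (simp add: segment_partition_def)
  have f_eq: "f ((0 # is) ! j) (is ! j)
      = max (b_ent V (E\<inverse>) is \<psi> (Suc j)) (pd_min V (E\<inverse>) (set (segment is \<psi> (Suc j))))" for j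
    using entering_boundary_eq_minimum_set[OF E visit]
    by (simp add: f_def X_def b_ent_def segment_def prefix_before_def)
  let ?w = "\<lambda>j. max 0 (int (b_ent V (E\<inverse>) is \<psi> j) - int M)
    + max 0 (int (pd_min V (E\<inverse>) (set (segment is \<psi> j))) - int M)"
  have sum: "W_top V (E\<inverse>) is \<psi> M + R_top V (E\<inverse>) is \<psi> M = (\<Sum>j = 1..length is. ?w j)"
    by (simp add: W_top_def R_top_def sum.distrib)
  have "int M * (int (k_part V E (2 * M)) - 1) \<le> (\<Sum>j = 1..length is. ?w j)"
  proof (cases "M = 0")
    case True
    then show ?thesis by (simp add: sum_nonneg)
  next
    case False
    have kp: "k_part V E (2 * M) \<le> length is"
      using k_part_le_segments[OF E visit part, of "2 * M"] "is"(3) False f_eq by auto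
    \<comment> \<open>The last segment is left out: greedy cutting guarantees the value
      \<open>2 * M\<close> only before it.\<close>
    have "int M \<le> ?w j" if "j \<in> {1..length is - 1}" for j
      using that "is"(4) False f_eq[of "j - 1"] by (cases j) (auto simp: max_def split: if_splits)
    then have "(\<Sum>j = 1..length is - 1. int M) \<le> (\<Sum>j = 1..length is - 1. ?w j)"
      by (intro sum_mono)
    also have "\<dots> \<le> (\<Sum>j = 1..length is. ?w j)"
      by (intro sum_mono2) auto
    finally have le: "int (length is - 1) * int M \<le> (\<Sum>j = 1..length is. ?w j)" by simp
    \<comment> \<open>The right-hand subtraction is truncated; for empty \<open>is\<close> the
      factors are -1 on the left and 0 on the right.\<close>
    have "int M * (int (k_part V E (2 * M)) - 1) \<le> int M * int (length is - 1)"
      using kp by (intro mult_left_mono) auto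
    then show ?thesis using le by (simp add: mult.commute)
  qed
  then have "int M * (int (k_part V E (2 * M)) - 1)
      \<le> W_top V (E\<inverse>) is \<psi> M + R_top V (E\<inverse>) is \<psi> M"
    unfolding sum .
  then show ?thesis using part unfolding n by blast
qed


section \<open>Phases of a computation\<close>

text \<open>Phases and cache occurrences refer to points in time, so the inductive run is unrolled
  into a sequence of states indexed by time.\<close>

lemma io_run_states:
  "io_run V E M s as s' \<Longrightarrow>
     \<exists>st. st 0 = s \<and> st (length as) = s' \<and>
       (\<forall>i < length as. io_step V E M (st i) (as ! i) (st (Suc i)))"
proof (induction rule: io_run.induct)
  case (Nil s)
  then show ?case by auto
next
  case (Cons s a s' as s'')
  then obtain st where st: "st 0 = s'" "st (length as) = s''"
    "\<forall>i < length as. io_step V E M (st i) (as ! i) (st (Suc i))" by blast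
  show ?case
  proof (intro exI[of _ "case_nat s st"] conjI allI impI)
    fix i assume "i < length (a # as)"
    then show "io_step V E M (case_nat s st i) ((a # as) ! i) (case_nat s st (Suc i))"
      using st Cons.hyps by (cases i) auto
  qed (use st in auto)
qed

text \<open>\<open>C i\<close> and \<open>S i\<close> are the memory contents before step
  \<open>i\<close>. The last assumption absorbs \<open>no_isolated\<close>: an output is not an
  input, hence it can reach slow memory only by a write.\<close>

locale io_trace =
  fixes V :: "'v set" and E :: "('v \<times> 'v) set" and M :: nat
    and as :: "'v action list" and C S :: "nat \<Rightarrow> 'v set"
  assumes dag: "dag V E"
    and C_0: "C 0 = {}" and S_0: "S 0 = inputs V E"
    and step: "i < length as \<Longrightarrow> io_step V E M (C i, S i) (as ! i) (C (Suc i), S (Suc i))"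
    and outputs_written: "outputs V E \<subseteq> S (length as) - inputs V E"
begin

section \<open>Invariants of cache and slow memory\<close>

lemma C_S_subset: "i \<le> length as \<Longrightarrow> C i \<subseteq> V \<and> S i \<subseteq> V"
proof (induction i)
  case 0
  then show ?case by (auto simp: C_0 S_0 inputs_def)
next
  case (Suc i)
  then have IH: "C i \<subseteq> V" "S i \<subseteq> V" by auto
  have "i < length as" using Suc.prems by simp
  from step[OF this] show ?case by cases (use IH in auto)
qed

lemma finite_C: "i \<le> length as \<Longrightarrow> finite (C i)"
  using C_S_subset dag by (metis dag_def finite_subset)

lemma card_C: "i \<le> length as \<Longrightarrow> card (C i) \<le> M"
proof (induction i)
  case 0
  then show ?case by (simp add: C_0)
next
  case (Suc i)
  then have IH: "card (C i) \<le> M" by simp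
  have "i < length as" using Suc.prems by simp
  from step[OF this] show ?case
  proof cases
    case (discard v)
    then show ?thesis using IH card_Diff1_le[of "C i" v] by simp
  qed (use IH in auto)
qed

lemma C_enters:
  assumes "i < length as" "v \<notin> C i" "v \<in> C (Suc i)"
  shows "v \<in> S i \<or> preds E v \<subseteq> C i"
  using step[OF assms(1)] assms(2,3) by cases auto

lemma S_enters:
  assumes "i < length as" "v \<notin> S i" "v \<in> S (Suc i)"
  shows "as ! i = Write v \<and> v \<in> C i"
  using step[OF assms(1)] assms(2,3) by cases auto

lemma S_mono:
  assumes "i \<le> j" "j \<le> length as" shows "S i \<subseteq> S j"
  using assms
proof (induction rule: dec_induct)
  case (step m)
  then show ?case using io_trace.step[OF io_trace_axioms, of m] by (auto elim!: io_step.cases)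
qed simp

section \<open>Occurrences of a value in the cache\<close>

lemma last_entry:
  "t \<le> length as \<Longrightarrow> v \<in> C t \<Longrightarrow>
     \<exists>r < t. v \<notin> C r \<and> (\<forall>j. r < j \<and> j \<le> t \<longrightarrow> v \<in> C j)"
proof (induction t)
  case 0
  then show ?case by (simp add: C_0)
next
  case (Suc t)
  show ?case
  proof (cases "v \<in> C t")
    case True
    with Suc obtain r where "r < t" "v \<notin> C r" "\<forall>j. r < j \<and> j \<le> t \<longrightarrow> v \<in> C j" by auto
    then show ?thesis using Suc.prems by (intro exI[of _ r]) (auto simp: le_Suc_eq)
  next
    case False
    then show ?thesis using Suc.prems by (intro exI[of _ t]) (auto simp: le_Suc_eq)
  qed
qed

lemma first_write:
  "t \<le> length as \<Longrightarrow> v \<in> S t \<Longrightarrow> v \<notin> inputs V E \<Longrightarrow>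
     \<exists>s < t. v \<notin> S s \<and> v \<in> C s \<and> as ! s = Write v"
proof (induction t)
  case 0
  then show ?case by (simp add: S_0)
next
  case (Suc t)
  show ?case
  proof (cases "v \<in> S t")
    case True
    with Suc show ?thesis by (auto intro: less_SucI)
  next
    case False
    then show ?thesis using Suc.prems S_enters[of t v] by auto
  qed
qed

text \<open>For a non-input the predecessors have to be in cache at \<open>r\<close>, whether step
  \<open>r\<close> evaluates \<open>v\<close> or not. This is what hands the choice of occurrences
  on from \<open>v\<close> to its predecessors.\<close>

definition enters_until :: "'v \<Rightarrow> nat \<Rightarrow> nat \<Rightarrow> bool" where
  "enters_until v r e \<longleftrightarrow> r < e \<and> (\<forall>j. r < j \<and> j \<le> e \<longrightarrow> v \<in> C j)
     \<and> (v \<in> inputs V E \<or> preds E v \<subseteq> C r)"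

text \<open>
  Before its first write a non-input is not in slow memory, so the entry into cache that
  precedes this write is an evaluation and not a read.
\<close>

lemma written_occurrence:
  assumes "t \<le> length as" "v \<in> S t" "v \<notin> inputs V E"
  shows "\<exists>r e. enters_until v r e \<and> e < t \<and> as ! e = Write v"
proof -
  obtain s where s: "s < t" "v \<notin> S s" "v \<in> C s" "as ! s = Write v"
    using first_write[OF assms] by blast
  obtain r where r: "r < s" "v \<notin> C r" "\<forall>j. r < j \<and> j \<le> s \<longrightarrow> v \<in> C j"
    using last_entry[of s v] s assms(1) by auto
  have "v \<notin> S r" using S_mono[of r s] r(1) s assms(1) by auto
  then have "preds E v \<subseteq> C r" using C_enters[of r v] r s(1) assms(1) by auto
  then show ?thesis using r s unfolding enters_until_def by blast
qed

text \<open>The last entry of \<open>v\<close> before \<open>t\<close> serves if it is an evaluation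
  or \<open>v\<close> is an input. If instead a non-input was read, it had been written before, and
  the occurrence ending in that write is taken.\<close>

lemma cached_occurrence:
  assumes "t \<le> length as" "v \<in> C t"
  shows "\<exists>r e. enters_until v r e \<and> (e = t \<or> e < t \<and> as ! e = Write v)"
proof -
  obtain r where r: "r < t" "v \<notin> C r" "\<forall>j. r < j \<and> j \<le> t \<longrightarrow> v \<in> C j"
    using last_entry[OF assms] by blast
  consider "v \<in> inputs V E \<or> preds E v \<subseteq> C r" | "v \<in> S r" "v \<notin> inputs V E"
    using C_enters[of r v] r assms(1) by auto
  then show ?thesis
  proof cases
    case 1
    then show ?thesis using r unfolding enters_until_def by blast
  next
    case 2
    then show ?thesis using written_occurrence[of r v] r(1) assms(1)
      by (meson less_imp_le_nat less_le_trans order_less_trans)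
  qed
qed

text \<open>Well-founded recursion from the outputs backwards. An output is charged to an occurrence
  ending in a write; any other vertex must be in cache when the earliest charged successor is, and
  is charged to an occurrence ending there or in an earlier write.\<close>

lemma charging_exists:
  "\<exists>\<tau>. \<forall>v. v \<in> V \<longrightarrow> (\<forall>w. (v, w) \<in> E \<longrightarrow> \<tau> v < \<tau> w) \<and>
     (\<exists>e < length as. enters_until v (\<tau> v) e \<and>
        (as ! e = Write v \<or> (\<exists>w. (v, w) \<in> E \<and> \<tau> w = e)))"
proof (rule dependent_wf_choice[where R = "E\<inverse>" and
    P = "\<lambda>\<tau> v r. v \<in> V \<longrightarrow> (\<forall>w. (v, w) \<in> E \<longrightarrow> r < \<tau> w) \<and>
     (\<exists>e < length as. enters_until v r e \<and>
        (as ! e = Write v \<or> (\<exists>w. (v, w) \<in> E \<and> \<tau> w = e)))"])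
  have fin: "finite E" using dag by (auto simp: dag_def intro: finite_subset)
  then show "wf (E\<inverse>)" using dag by (auto simp: dag_def intro: finite_acyclic_wf_converse)
  \<comment> \<open>The condition on \<open>v\<close> consults the charges of its successors only,
    as recursion along \<open>E\<inverse>\<close> demands.\<close>
  show "(v \<in> V \<longrightarrow> (\<forall>w. (v, w) \<in> E \<longrightarrow> r < f w) \<and> (\<exists>e < length as. enters_until v r e \<and>
          (as ! e = Write v \<or> (\<exists>w. (v, w) \<in> E \<and> f w = e)))) =
        (v \<in> V \<longrightarrow> (\<forall>w. (v, w) \<in> E \<longrightarrow> r < g w) \<and> (\<exists>e < length as. enters_until v r e \<and>
          (as ! e = Write v \<or> (\<exists>w. (v, w) \<in> E \<and> g w = e))))"
    if "\<And>z. (z, v) \<in> E\<inverse> \<Longrightarrow> f z = g z" for f g :: "'v \<Rightarrow> nat" and v r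
    using that by auto
next
  fix v and \<tau> :: "'v \<Rightarrow> nat"
  assume IH: "\<And>w. (w, v) \<in> E\<inverse> \<Longrightarrow> w \<in> V \<longrightarrow> (\<forall>x. (w, x) \<in> E \<longrightarrow> \<tau> w < \<tau> x) \<and>
     (\<exists>e < length as. enters_until w (\<tau> w) e \<and>
        (as ! e = Write w \<or> (\<exists>x. (w, x) \<in> E \<and> \<tau> x = e)))"
  show "\<exists>r. v \<in> V \<longrightarrow> (\<forall>w. (v, w) \<in> E \<longrightarrow> r < \<tau> w) \<and> (\<exists>e < length as. enters_until v r e \<and>
        (as ! e = Write v \<or> (\<exists>w. (v, w) \<in> E \<and> \<tau> w = e)))"
  proof (cases "v \<in> V \<and> (\<exists>w. (v, w) \<in> E)")
    case False
    show ?thesis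
    proof (cases "v \<in> V")
      case True
      then have "v \<in> outputs V E" using False by (auto simp: outputs_def)
      then show ?thesis
        using written_occurrence[of "length as" v] outputs_written False by blast
    qed simp
  next
    case True
    define W where "W = {w. (v, w) \<in> E}"
    have "W \<subseteq> V" using dag by (auto simp: W_def dag_def)
    then have W: "finite W" "W \<noteq> {}"
      using dag True by (auto simp: W_def dag_def intro: finite_subset)
    \<comment> \<open>Stepping back from the earliest charged successor places the charge of
      \<open>v\<close> before those of all its successors.\<close>
    define t where "t = Min (\<tau> ` W)"
    have "t \<in> \<tau> ` W" unfolding t_def using W by (intro Min_in) auto
    then obtain w where w: "(v, w) \<in> E" "\<tau> w = t" by (auto simp: W_def)
    have t_le: "t \<le> \<tau> x" if "(v, x) \<in> E" for x
      unfolding t_def using W that by (intro Min_le) (auto simp: W_def)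
    obtain e where e: "e < length as" "enters_until w t e"
      using IH[of w] w \<open>W \<subseteq> V\<close> by (auto simp: W_def)
    \<comment> \<open>Having the predecessor \<open>v\<close>, \<open>w\<close> is no input, so its
      occurrence requires \<open>v\<close> in cache at \<open>t\<close>.\<close>
    have "w \<notin> inputs V E" using w by (auto simp: inputs_def)
    then have "v \<in> C t" using e(2) w(1) by (auto simp: enters_until_def preds_def)
    moreover have "t < length as" using e by (auto simp: enters_until_def)
    ultimately obtain r e' where r: "enters_until v r e'" "e' = t \<or> e' < t \<and> as ! e' = Write v"
      using cached_occurrence[of t v] by auto
    then have "r < t" by (auto simp: enters_until_def)
    then have "\<forall>x. (v, x) \<in> E \<longrightarrow> r < \<tau> x" using t_le less_le_trans by blast
    moreover have "e' < length as" using r(2) \<open>t < length as\<close> by auto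
    moreover have "as ! e' = Write v \<or> (\<exists>x. (v, x) \<in> E \<and> \<tau> x = e')" using r(2) w by blast
    ultimately show ?thesis using r(1) by blast
  qed
qed

section \<open>Division of time by I/O count\<close>

definition io_before :: "nat \<Rightarrow> nat" where
  "io_before t = io_cost (take t as)"

definition phase :: "nat \<Rightarrow> nat set" where
  "phase i = {t. t < length as \<and> io_before t div M = i}"

definition phase_io :: "nat \<Rightarrow> 'v set" where
  "phase_io i = {v. \<exists>t \<in> phase i. as ! t = Read v \<or> as ! t = Write v}"

text \<open>The alternative \<open>t = length as\<close> gives phases that are never reached the end
  of the computation as their start.\<close>

definition phase_start :: "nat \<Rightarrow> nat" where
  "phase_start i = (LEAST t. t = length as \<or> i * M \<le> io_before t)"

lemma io_before_Suc:
  "t < length as \<Longrightarrow> io_before (Suc t) = io_before t + (if is_io (as ! t) then 1 else 0)"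
  by (simp add: io_before_def io_cost_def take_Suc_conv_app_nth)

lemma io_before_mono: "s \<le> t \<Longrightarrow> io_before s \<le> io_before t"
proof -
  assume "s \<le> t"
  then have "take t as = take s as @ take (t - s) (drop s as)"
    using take_add[of s "t - s" as] by simp
  then show ?thesis by (simp add: io_before_def io_cost_def)
qed

lemma phase_start_le: "phase_start i \<le> length as"
  unfolding phase_start_def by (rule Least_le) simp

lemma phase_start_cases: "phase_start i = length as \<or> i * M \<le> io_before (phase_start i)"
  unfolding phase_start_def by (rule LeastI[of _ "length as"]) simp

lemma phase_start_leI: "i * M \<le> io_before t \<Longrightarrow> phase_start i \<le> t"
  unfolding phase_start_def by (rule Least_le) simp

lemma phase_start_le_phase:
  assumes "t \<in> phase i" shows "phase_start i \<le> t"
  using assms by (intro phase_start_leI) (auto simp: phase_def)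

lemma between_phase_start:
  assumes "0 < M" "t \<in> phase i" "phase_start i \<le> s" "s \<le> t"
  shows "s \<in> phase i"
proof -
  have "i * M \<le> io_before s"
    using phase_start_cases[of i] assms io_before_mono[OF assms(3)] by (auto simp: phase_def)
  then have "i \<le> io_before s div M" using assms(1) by (simp add: less_eq_div_iff_mult_less_eq)
  moreover have "io_before s div M \<le> i"
    using io_before_mono[OF assms(4)] assms(2) div_le_mono by (auto simp: phase_def)
  ultimately show ?thesis using assms by (auto simp: phase_def)
qed

lemma phase_less_next_start:
  assumes "0 < M" "t \<in> phase i" shows "t < phase_start (Suc i)"
proof (rule ccontr)
  assume "\<not> t < phase_start (Suc i)"
  then have "phase_start (Suc i) \<le> t" by simp
  then have "Suc i * M \<le> io_before t"
    using phase_start_cases[of "Suc i"] io_before_mono[of "phase_start (Suc i)" t] assms(2)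
    by (auto simp: phase_def)
  then have "Suc i \<le> io_before t div M"
    using assms(1) less_eq_div_iff_mult_less_eq by blast
  then show False using assms(2) by (simp add: phase_def)
qed

text \<open>Every I/O step raises \<open>io_before\<close>, so this counter is injective on the I/O
  steps of a phase, where it takes values in a window of length \<open>M\<close>.\<close>

lemma finite_card_phase_io:
  assumes "0 < M" shows "finite (phase_io i) \<and> card (phase_io i) \<le> M"
proof -
  let ?T = "{t \<in> phase i. is_io (as ! t)}"
  have less: "io_before s < io_before t" if "s \<in> ?T" "s < t" for s t
    using that io_before_Suc[of s] io_before_mono[of "Suc s" t] by (auto simp: phase_def)
  have "inj_on io_before ?T"
    by (rule linorder_inj_onI) (use less in fastforce)+
  moreover have "io_before ` ?T \<subseteq> {i * M..<i * M + M}"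
    using assms by (auto simp: phase_def) (metis div_mult_mod_eq nat_add_left_cancel_less mod_less_divisor)
  ultimately have "card ?T \<le> M"
    using card_inj_on_le[of io_before ?T "{i * M..<i * M + M}"] by simp
  moreover have fin: "finite ?T" by (simp add: phase_def)
  moreover have sub: "phase_io i \<subseteq> (\<lambda>t. THE v. as ! t = Read v \<or> as ! t = Write v) ` ?T"
    by (force simp: phase_io_def image_iff)
  ultimately show ?thesis
    by (meson surj_card_le finite_surj le_trans)
qed

text \<open>Induction over time within the phase. A value newly in cache was either read, hence in
  \<open>phase_io i\<close>, or evaluated, and then its predecessor on the path was already in
  cache.\<close>

lemma phase_dominated:
  assumes "phase_start i \<le> t" "t \<le> length as" "\<And>s. phase_start i \<le> s \<Longrightarrow> s < t \<Longrightarrow> s \<in> phase i"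
    and "dpath E p" "hd p \<in> inputs V E" "last p \<in> C t"
  shows "set p \<inter> (C (phase_start i) \<union> phase_io i) \<noteq> {}"
  using assms
proof (induction t arbitrary: p rule: dec_induct)
  case base
  then show ?case using last_in_set[of p] unfolding dpath_def by blast
next
  case (step t)
  have p: "p \<noteq> []" "last p \<in> set p" using step.prems by (auto simp: dpath_def)
  have IH: "set q \<inter> (C (phase_start i) \<union> phase_io i) \<noteq> {}"
    if "dpath E q" "hd q \<in> inputs V E" "last q \<in> C t" for q
    using step.IH[of q] step.prems that by simp
  have t: "t < length as" "t \<in> phase i" using step by auto
  from io_trace.step[OF io_trace_axioms t(1)] show ?case
  proof cases
    case (evaluate v)
    show ?thesis
    proof (cases "last p \<in> C t")
      case True
      then show ?thesis using IH step.prems by blast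
    next
      case False
      then have v: "last p = v" using evaluate step.prems by auto
      define q where "q = butlast p"
      have p_eq: "p = q @ [v]" using append_butlast_last_id[OF p(1)] v by (simp add: q_def)
      \<comment> \<open>An evaluated vertex is not an input, whereas the path starts at one.\<close>
      have "q \<noteq> []" using p_eq step.prems evaluate by auto
      then have "dpath E q" "(last q, v) \<in> E" "hd q = hd p"
        using step.prems(3) p_eq by (auto simp: dpath_def successively_append_iff)
      then show ?thesis
        using IH[of q] evaluate step.prems p_eq by (auto simp: preds_def)
    qed
  next
    case (read v)
    then show ?thesis
      using IH[of p] step.prems t p by (cases "last p \<in> C t") (auto simp: phase_io_def)
  next
    case ("write" v)
    then show ?thesis using IH[of p] step.prems by auto
  next
    case (discard v)
    then show ?thesis using IH[of p] step.prems by auto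
  qed
qed

lemma k_part_bound:
  assumes M: "0 < M" shows "M * (k_part V E (2 * M) - 1) \<le> io_cost as"
proof -
  obtain \<tau> where \<tau>: "\<And>v w. v \<in> V \<Longrightarrow> (v, w) \<in> E \<Longrightarrow> \<tau> v < \<tau> w"
    "\<And>v. v \<in> V \<Longrightarrow> \<exists>e < length as. enters_until v (\<tau> v) e \<and>
        (as ! e = Write v \<or> (\<exists>w. (v, w) \<in> E \<and> \<tau> w = e))"
    using charging_exists by blast
  have EV: "u \<in> V" "v \<in> V" if "(u, v) \<in> E" for u v using that dag by (auto simp: dag_def)
  \<comment> \<open>The label is the phase of the charged step; it is monotone because
    \<open>\<tau>\<close> increases along edges.\<close>
  define \<sigma> where "\<sigma> v = io_before (\<tau> v) div M" for v
  have \<tau>_phase: "\<tau> v \<in> phase (\<sigma> v)" if "v \<in> V" for v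
    using \<tau>(2)[OF that] by (auto simp: phase_def \<sigma>_def enters_until_def)
  have \<tau>_cached: "v \<in> C (Suc (\<tau> v))" if "v \<in> V" for v
    using \<tau>(2)[OF that] by (auto simp: enters_until_def)
  have mono: "\<sigma> u \<le> \<sigma> v" if "(u, v) \<in> E" for u v
    using \<tau>(1)[OF EV(1)[OF that] that] io_before_mono[of "\<tau> u" "\<tau> v"]
    by (simp add: \<sigma>_def div_le_mono)
  have total: "io_before t \<le> io_cost as" if "t \<le> length as" for t
    using io_before_mono[OF that] by (simp add: io_before_def)
  have size: "card (C t \<union> phase_io i) \<le> 2 * M" if "t \<le> length as" for t i
    using card_Un_le[of "C t" "phase_io i"] card_C[OF that] finite_card_phase_io[OF M, of i] by simp
  have "k_part V E (2 * M) \<le> Suc (io_cost as div M)"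
  proof (rule k_part_le_labels[of V \<sigma>])
    show "\<sigma> v < Suc (io_cost as div M)" if "v \<in> V" for v
      using total \<tau>_phase[OF that] by (auto simp: phase_def \<sigma>_def less_Suc_eq_le intro!: div_le_mono)
    show "\<sigma> u \<le> \<sigma> v" if "(u, v) \<in> E" for u v using mono[OF that] .
    fix i
    let ?D = "C (phase_start i) \<union> phase_io i"
    have "phase_io i \<subseteq> V"
    proof
      fix v assume "v \<in> phase_io i"
      then obtain t where t: "t < length as" "as ! t = Read v \<or> as ! t = Write v"
        by (auto simp: phase_io_def phase_def)
      from step[OF t(1)] t(2) have "v \<in> S t \<union> C t" by (auto elim: io_step.cases)
      then show "v \<in> V" using C_S_subset[of t] t by auto
    qed
    then have "?D \<subseteq> V" using C_S_subset[OF phase_start_le] by blast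
    moreover have "set p \<inter> ?D \<noteq> {}"
      if "dpath E p" "hd p \<in> inputs V E" "last p \<in> V" "\<sigma> (last p) = i" for p
    \<comment> \<open>The vertex is known to be in cache only after its charged step, hence the
      successor time.\<close>
    proof (rule phase_dominated[of _ "Suc (\<tau> (last p))"])
      have \<tau>p: "\<tau> (last p) \<in> phase i" using \<tau>_phase that by blast
      then show "phase_start i \<le> Suc (\<tau> (last p))"
        using phase_start_le_phase by (simp add: le_SucI)
      show "Suc (\<tau> (last p)) \<le> length as" using \<tau>p by (auto simp: phase_def)
      show "s \<in> phase i" if "phase_start i \<le> s" "s < Suc (\<tau> (last p))" for s
        using between_phase_start[OF M \<tau>p] that by simp
    qed (use that \<tau>_cached in auto)
    ultimately have "dominator V E ?D {v \<in> V. \<sigma> v = i}" by (auto simp: dominator_def)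
    then show "\<exists>D. dominator V E D {v \<in> V. \<sigma> v = i} \<and> card D \<le> 2 * M"
      using size[OF phase_start_le] by blast
    \<comment> \<open>Values in cache at the end of phase \<open>i\<close>, that is, at the start of
      the next, or moved by I/O during the phase.\<close>
    let ?F = "C (phase_start (Suc i)) \<union> phase_io i"
    have "minimum_set E {v \<in> V. \<sigma> v = i} \<subseteq> ?F"
    proof
      fix v assume "v \<in> minimum_set E {v \<in> V. \<sigma> v = i}"
      then have v: "v \<in> V" "\<sigma> v = i" "\<And>w. (v, w) \<in> E \<Longrightarrow> \<sigma> w \<noteq> i"
        using EV(2) unfolding minimum_set_def by blast+
      obtain e where e: "e < length as" "enters_until v (\<tau> v) e"
        "as ! e = Write v \<or> (\<exists>w. (v, w) \<in> E \<and> \<tau> w = e)"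
        using \<tau>(2)[OF v(1)] by blast
      have "\<tau> v < e" using e(2) by (simp add: enters_until_def)
      then have le: "i \<le> io_before e div M"
        using io_before_mono[of "\<tau> v" e] v(2) by (auto simp: \<sigma>_def intro: div_le_mono)
      show "v \<in> ?F"
      proof (cases "io_before e div M = i")
        case True
        \<comment> \<open>A successor charged to \<open>e\<close> would have label \<open>i\<close>,
          contrary to \<open>v\<close> lying in the minimum set.\<close>
        then have "as ! e = Write v" using e(3) v(3) by (auto simp: \<sigma>_def)
        then show ?thesis using True e(1) by (auto simp: phase_io_def phase_def)
      next
        case False
        then have "Suc i \<le> io_before e div M" using le by simp
        then have "Suc i * M \<le> io_before e" using M less_eq_div_iff_mult_less_eq by blast
        then have "phase_start (Suc i) \<le> e" by (rule phase_start_leI)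
        moreover have "\<tau> v < phase_start (Suc i)"
          using phase_less_next_start[OF M] \<tau>_phase[OF v(1)] v(2) by simp
        \<comment> \<open>The occurrence begins before the next phase and ends no earlier than its
          start, so \<open>v\<close> is in cache at that moment.\<close>
        ultimately show ?thesis using e(2) by (auto simp: enters_until_def)
      qed
    qed
    moreover have "finite ?F" using finite_C[OF phase_start_le] finite_card_phase_io[OF M] by simp
    ultimately show "card (minimum_set E {v \<in> V. \<sigma> v = i}) \<le> 2 * M"
      using size[OF phase_start_le] card_mono le_trans by meson
  qed
  then have "M * (k_part V E (2 * M) - 1) \<le> M * (io_cost as div M)"
    by (intro mult_left_mono) auto
  also have "\<dots> \<le> io_cost as" by simp
  finally show ?thesis .
qed

end

lemma computation_cost_bound:
  assumes "dag V E" "no_isolated V E" "computation V E M as"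
  shows "M * (k_part V E (2 * M) - 1) \<le> io_cost as"
proof (cases "M = 0")
  case False
  obtain C' S' where run: "io_run V E M ({}, inputs V E) as (C', S')" "outputs V E \<subseteq> S'"
    using assms(3) by (auto simp: computation_def)
  obtain st where st: "st 0 = ({}, inputs V E)" "st (length as) = (C', S')"
    "\<forall>i < length as. io_step V E M (st i) (as ! i) (st (Suc i))"
    using io_run_states[OF run(1)] by blast
  interpret io_trace V E M as "fst \<circ> st" "snd \<circ> st"
  proof
    show "outputs V E \<subseteq> (snd \<circ> st) (length as) - inputs V E"
      using assms(2) st(2) run(2) by (auto simp: no_isolated_def)
  qed (use assms(1) st in simp_all)
  show ?thesis using k_part_bound False by simp
qed simp

theorem theorem21:
  fixes V :: "'v set" and E :: "('v \<times> 'v) set" and M :: nat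
  assumes "dag V E"
  shows "(\<forall>\<psi>. top_visit V (E\<inverse>) \<psi> \<longrightarrow>
            (\<exists>is. segment_partition (card V) is \<and>
                  W_top V (E\<inverse>) is \<psi> M + R_top V (E\<inverse>) is \<psi> M
                    \<ge> int M * (int (k_part V E (2 * M)) - 1)))
       \<and> (no_isolated V E \<longrightarrow> IO V E M \<ge> enat (M * (k_part V E (2 * M) - 1)))"
proof (intro conjI allI impI)
  fix \<psi> assume "top_visit V (E\<inverse>) \<psi>"
  then show "\<exists>is. segment_partition (card V) is \<and>
                  W_top V (E\<inverse>) is \<psi> M + R_top V (E\<inverse>) is \<psi> M
                    \<ge> int M * (int (k_part V E (2 * M)) - 1)"
    by (rule segment_partition_lower_bound[OF assms])
next
  assume "no_isolated V E"
  \<comment> \<open>The bound holds for each computation and hence for the infimum, which is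
    infinite if there is none.\<close>
  then show "IO V E M \<ge> enat (M * (k_part V E (2 * M) - 1))"
    unfolding IO_def using computation_cost_bound[OF assms] by (intro INF_greatest) simp
qed

end
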